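(* Let $F$ be an infinite field and let $p=p_1p_2\in F\langle\mathcal X\rangle$, where $p_1,p_2\in F\langle\mathcal X\rangle$ are multilinear polynomials in disjoint sets of variables such that $p_1(\mathrm{M}_\infty(F))\ne\{0\}$ and $p_2(\mathrm{M}_\infty(F))\neq\{0\}$. Then $$p(\mathrm{M}_\infty(F))=\mathrm{M}_\infty(F).$$
   Context: $F\langle\mathcal X\rangle$ is the free associative $F$-algebra on noncommuting variables $\mathcal X=\{x_1,x_2,\dots\}$. A polynomial is multilinear (in $m\ge1$ variables) if, up to naming of its $m$ distinct variables, it has the form $\sum_{\sigma\in S_m}\lambda_\sigma x_{\sigma(1)}\cdots x_{\sigma(m)}$ with $\lambda_\sigma\in F$. For an $F$-algebra $\mathcal A$ and a polynomial $p$ in $m$ variables, $p(\mathcal A)=\{p(a_1,\dots,a_m)\mid a_i\in\mathcal A\}$. $\mathrm{M}_\infty(F)=\bigcup_{n\ge1}\mathrm{M}_n(F)$ is the finitary matrix algebra: the union of the chain in which $\mathrm{M}_n(F)$ is embedded in $\mathrm{M}_{n+1}(F)$ by appending a zero row and a zero column; equivalently, countably infinite matrices with only finitely many nonzero entries. *)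

theory Defs
  imports HOL.Vector_Spaces "HOL-Library.Poly_Mapping" "HOL-Combinatorics.Permutations"
begin

text \<open>
  The wrapper type makes words a monoid under concatenation, written additively. The library
  product of finitely supported functions on words is then the product of the monoid algebra
  of the free monoid, i.e. of the free associative algebra on countably many variables
  (indexed by \<^typ>\<open>nat\<close>, hence starting with 0).
\<close>

datatype word = Word (letters: "nat list")

instantiation word :: monoid_add
begin

definition "0 = Word []"

definition "u + v = Word (letters u @ letters v)"

instance
  by standard (simp_all add: zero_word_def plus_word_def)

end

type_synonym 'a free_algebra = "word \<Rightarrow>\<^sub>0 'a"

definition vars :: "'a::zero free_algebra \<Rightarrow> nat set" where
  "vars p = (\<Union>w\<in>Poly_Mapping.keys p. set (letters w))"

definition multilinear :: "'a::comm_monoid_add free_algebra \<Rightarrow> bool" where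
  "multilinear p \<longleftrightarrow>
    (\<exists>m x c. 1 \<le> m \<and> inj_on x {..<m} \<and>
      p = (\<Sum>\<sigma> | \<sigma> permutes {..<m}.
            Poly_Mapping.single (Word (map (\<lambda>i. x (\<sigma> i)) [0..<m])) (c \<sigma>)))"

text \<open>
  Evaluation in an algebra that need not have a unit. Its scalar multiplication is passed
  as an argument. The empty word has no value in such an algebra; it is sent to 0, so
  \<open>eval_poly\<close> is meaningful only for polynomials with zero constant term. Multilinear
  polynomials and their products are of this kind.
\<close>

fun eval_word :: "(nat \<Rightarrow> 'b::ring) \<Rightarrow> nat list \<Rightarrow> 'b" where
  "eval_word a [] = 0"
| "eval_word a [i] = a i"
| "eval_word a (i # j # w) = a i * eval_word a (j # w)"

definition eval_poly :: "('a::zero \<Rightarrow> 'b::ring \<Rightarrow> 'b) \<Rightarrow> (nat \<Rightarrow> 'b) \<Rightarrow> 'a free_algebra \<Rightarrow> 'b" where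
  "eval_poly scale a p =
    (\<Sum>w\<in>Poly_Mapping.keys p. scale (Poly_Mapping.lookup p w) (eval_word a (letters w)))"

text \<open>
  Assigning values to all variables, rather than only to those of the polynomial,
  gives the same set of values.
\<close>

definition poly_image :: "('a::zero \<Rightarrow> 'b::ring \<Rightarrow> 'b) \<Rightarrow> 'a free_algebra \<Rightarrow> 'b set" where
  "poly_image scale p = {eval_poly scale a p | a. True}"

lemma eval_word_append:
  "u \<noteq> [] \<Longrightarrow> v \<noteq> [] \<Longrightarrow> eval_word a (u @ v) = eval_word a u * eval_word a v"
proof (induction a u rule: eval_word.induct)
  case (2 a i)
  then show ?case by (cases v) auto
qed (auto simp: mult.assoc)

lemma eval_word_cong:
  "(\<And>i. i \<in> set u \<Longrightarrow> a i = b i) \<Longrightarrow> eval_word a u = eval_word b u"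
  by (induction a u rule: eval_word.induct) auto

lemma eval_poly_cong:
  "(\<And>i. i \<in> vars p \<Longrightarrow> a i = b i) \<Longrightarrow> eval_poly scale a p = eval_poly scale b p"
  unfolding eval_poly_def vars_def
  by (intro sum.cong arg_cong2[where f = scale] eval_word_cong refl) auto

typedef (overloaded) 'a finmat =
  "{A :: nat \<Rightarrow> nat \<Rightarrow> 'a::zero. finite {(i, j). A i j \<noteq> 0}}"
  morphisms entry Finmat
  by (rule exI[of _ "\<lambda>_ _. 0"]) simp

setup_lifting type_definition_finmat

text \<open>
  By the following equivalence, \<open>finmat\<close> is the union of the algebras of \<open>n \<times> n\<close> matrices, each placed
  in the upper left corner and padded with zeros.
\<close>

lemma finite_support_iff:
  fixes A :: "nat \<Rightarrow> nat \<Rightarrow> 'a::zero"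
  shows "finite {(i, j). A i j \<noteq> 0} \<longleftrightarrow> (\<exists>n. \<forall>i j. A i j \<noteq> 0 \<longrightarrow> i < n \<and> j < n)"
proof
  assume "finite {(i, j). A i j \<noteq> 0}"
  then have "finite (fst ` {(i, j). A i j \<noteq> 0} \<union> snd ` {(i, j). A i j \<noteq> 0})"
    by blast
  then obtain n where "\<forall>k\<in>fst ` {(i, j). A i j \<noteq> 0} \<union> snd ` {(i, j). A i j \<noteq> 0}. k < n"
    unfolding finite_nat_set_iff_bounded by blast
  then have "i < n \<and> j < n" if "A i j \<noteq> 0" for i j
    using that by (metis (mono_tags, lifting) UnCI case_prodI fst_conv image_eqI mem_Collect_eq snd_conv)
  then show "\<exists>n. \<forall>i j. A i j \<noteq> 0 \<longrightarrow> i < n \<and> j < n"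
    by blast
next
  assume "\<exists>n. \<forall>i j. A i j \<noteq> 0 \<longrightarrow> i < n \<and> j < n"
  then obtain n where "\<forall>i j. A i j \<noteq> 0 \<longrightarrow> i < n \<and> j < n" ..
  then have "{(i, j). A i j \<noteq> 0} \<subseteq> {..<n} \<times> {..<n}"
    by auto
  then show "finite {(i, j). A i j \<noteq> 0}"
    by (rule finite_subset) simp
qed

lemma entry_bounded: "\<exists>n. \<forall>i j. entry A i j \<noteq> 0 \<longrightarrow> i < n \<and> j < n"
  using entry[of A] unfolding mem_Collect_eq finite_support_iff .

lemma matprod_eq_sum:
  fixes A B :: "nat \<Rightarrow> nat \<Rightarrow> 'a::semiring_0"
  assumes "\<forall>i j. A i j \<noteq> 0 \<longrightarrow> i < n \<and> j < n"
  shows "(\<Sum>k. A i k * B k j) = (\<Sum>k<n. A i k * B k j)"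
proof (rule Sum_any.expand_superset)
  show "{k. A i k * B k j \<noteq> 0} \<subseteq> {..<n}"
    using assms by (auto dest: mult_not_zero)
qed simp

instantiation finmat :: (ring) ring
begin

lift_definition zero_finmat :: "'a finmat" is "\<lambda>_ _. 0"
  by simp

lift_definition plus_finmat :: "'a finmat \<Rightarrow> 'a finmat \<Rightarrow> 'a finmat"
  is "\<lambda>A B i j. A i j + B i j"
proof -
  fix A B :: "nat \<Rightarrow> nat \<Rightarrow> 'a"
  assume "finite {(i, j). A i j \<noteq> 0}" "finite {(i, j). B i j \<noteq> 0}"
  then show "finite {(i, j). A i j + B i j \<noteq> 0}"
    by (rule finite_subset[OF _ finite_UnI, rotated]) auto
qed

lift_definition uminus_finmat :: "'a finmat \<Rightarrow> 'a finmat" is "\<lambda>A i j. - A i j"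
  by simp

lift_definition minus_finmat :: "'a finmat \<Rightarrow> 'a finmat \<Rightarrow> 'a finmat"
  is "\<lambda>A B i j. A i j - B i j"
proof -
  fix A B :: "nat \<Rightarrow> nat \<Rightarrow> 'a"
  assume "finite {(i, j). A i j \<noteq> 0}" "finite {(i, j). B i j \<noteq> 0}"
  then show "finite {(i, j). A i j - B i j \<noteq> 0}"
    by (rule finite_subset[OF _ finite_UnI, rotated]) auto
qed

lift_definition times_finmat :: "'a finmat \<Rightarrow> 'a finmat \<Rightarrow> 'a finmat"
  is "\<lambda>A B i j. \<Sum>k. A i k * B k j"
proof -
  fix A B :: "nat \<Rightarrow> nat \<Rightarrow> 'a"
  assume A: "finite {(i, j). A i j \<noteq> 0}" and B: "finite {(i, j). B i j \<noteq> 0}"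
  have "{(i, j). (\<Sum>k. A i k * B k j) \<noteq> 0}
      \<subseteq> fst ` {(i, j). A i j \<noteq> 0} \<times> snd ` {(i, j). B i j \<noteq> 0}"
  proof (rule subrelI)
    fix i j
    assume "(i, j) \<in> {(i, j). (\<Sum>k. A i k * B k j) \<noteq> 0}"
    then have "(\<Sum>k. A i k * B k j) \<noteq> 0"
      by simp
    then obtain k where "A i k * B k j \<noteq> 0"
      by (rule Sum_any.not_neutral_obtains_not_neutral)
    then have "A i k \<noteq> 0" "B k j \<noteq> 0"
      by auto
    then show "(i, j) \<in> fst ` {(i, j). A i j \<noteq> 0} \<times> snd ` {(i, j). B i j \<noteq> 0}"
      by force
  qed
  then show "finite {(i, j). (\<Sum>k. A i k * B k j) \<noteq> 0}"
    by (rule finite_subset) (use A B in simp)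
qed

instance
proof
  fix A B C :: "'a finmat"
  have mult: "entry (X * Y) i j = (\<Sum>k<n. entry X i k * entry Y k j)"
    if "\<forall>i j. entry X i j \<noteq> 0 \<longrightarrow> i < n \<and> j < n" for X Y :: "'a finmat" and n i j
    unfolding times_finmat.rep_eq using that by (rule matprod_eq_sum)
  obtain n1 where "\<forall>i j. entry A i j \<noteq> 0 \<longrightarrow> i < n1 \<and> j < n1"
    using entry_bounded by blast
  moreover obtain n2 where "\<forall>i j. entry B i j \<noteq> 0 \<longrightarrow> i < n2 \<and> j < n2"
    using entry_bounded by blast
  moreover obtain n3 where "\<forall>i j. entry (A * B) i j \<noteq> 0 \<longrightarrow> i < n3 \<and> j < n3"
    using entry_bounded by blast
  moreover define n where "n = max n1 (max n2 n3)"
  ultimately have A: "\<forall>i j. entry A i j \<noteq> 0 \<longrightarrow> i < n \<and> j < n"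
    and B: "\<forall>i j. entry B i j \<noteq> 0 \<longrightarrow> i < n \<and> j < n"
    and AB: "\<forall>i j. entry (A * B) i j \<noteq> 0 \<longrightarrow> i < n \<and> j < n"
    by (simp_all add: less_max_iff_disj)
  then have plus: "\<forall>i j. entry (A + B) i j \<noteq> 0 \<longrightarrow> i < n \<and> j < n"
    unfolding plus_finmat.rep_eq by (metis add_0)
  show "A * B * C = A * (B * C)"
  proof (rule entry_inject[THEN iffD1], intro ext)
    fix i j
    have "entry (A * B * C) i j = (\<Sum>k<n. \<Sum>l<n. entry A i l * entry B l k * entry C k j)"
      by (simp add: mult[OF AB] mult[OF A] sum_distrib_right)
    also have "\<dots> = (\<Sum>l<n. \<Sum>k<n. entry A i l * entry B l k * entry C k j)"
      by (rule sum.swap)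
    also have "\<dots> = entry (A * (B * C)) i j"
      by (simp add: mult[OF A] mult[OF B] sum_distrib_left mult.assoc)
    finally show "entry (A * B * C) i j = entry (A * (B * C)) i j" .
  qed
  show "(A + B) * C = A * C + B * C"
    by (rule entry_inject[THEN iffD1], intro ext)
      (simp add: mult[OF plus] mult[OF A] mult[OF B] plus_finmat.rep_eq distrib_right sum.distrib)
  show "A * (B + C) = A * B + A * C"
    by (rule entry_inject[THEN iffD1], intro ext)
      (simp add: mult[OF A] plus_finmat.rep_eq distrib_left sum.distrib)
  show "A + B + C = A + (B + C)"
    by transfer (simp add: add.assoc)
  show "A + B = B + A"
    by transfer (simp add: add.commute)
  show "0 + A = A"
    by transfer simp
  show "- A + A = 0"
    by transfer simp
  show "A - B = A + - B"
    by transfer simp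
qed

end

lift_definition finmat_scale :: "'a::ring \<Rightarrow> 'a finmat \<Rightarrow> 'a finmat"
  is "\<lambda>c A i j. c * A i j"
  by (rule finite_subset[rotated]) auto

lemma vector_space_finmat_scale: "vector_space (finmat_scale :: 'a::field \<Rightarrow> _)"
proof (unfold_locales)
  fix a b :: 'a and x y :: "'a finmat"
  show "finmat_scale a (x + y) = finmat_scale a x + finmat_scale a y"
    by transfer (simp add: algebra_simps)
  show "finmat_scale (a + b) x = finmat_scale a x + finmat_scale b x"
    by transfer (simp add: algebra_simps)
  show "finmat_scale a (finmat_scale b x) = finmat_scale (a * b) x"
    by transfer (simp add: algebra_simps)
  show "finmat_scale 1 x = x"
    by transfer simp
qed

lemma finmat_scale_mult:
  fixes c :: "'a::field"
  shows "finmat_scale c A * B = finmat_scale c (A * B)"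
    and "A * finmat_scale c B = finmat_scale c (A * B)"
proof -
  have mult: "entry (X * Y) i j = (\<Sum>k<n. entry X i k * entry Y k j)"
    if "\<forall>i j. entry X i j \<noteq> 0 \<longrightarrow> i < n \<and> j < n" for X Y :: "'a finmat" and n i j
    unfolding times_finmat.rep_eq using that by (rule matprod_eq_sum)
  obtain n where A: "\<forall>i j. entry A i j \<noteq> 0 \<longrightarrow> i < n \<and> j < n"
    using entry_bounded by blast
  then have cA: "\<forall>i j. entry (finmat_scale c A) i j \<noteq> 0 \<longrightarrow> i < n \<and> j < n"
    by (auto simp: finmat_scale.rep_eq)
  show "finmat_scale c A * B = finmat_scale c (A * B)"
    by (rule entry_inject[THEN iffD1], intro ext)
      (simp add: mult[OF cA] mult[OF A] finmat_scale.rep_eq sum_distrib_left mult.assoc)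
  show "A * finmat_scale c B = finmat_scale c (A * B)"
    by (rule entry_inject[THEN iffD1], intro ext)
      (simp add: mult[OF A] finmat_scale.rep_eq sum_distrib_left mult.left_commute)
qed

end

theory Submission
  imports Defs
begin

text \<open>
  In block matrices with blocks indexed by natural numbers, take a path
  \<open>b 0, b 1, \<dots>, b m\<close> of distinct block indices and put a block in position
  \<open>(b k, b (k + 1))\<close> for each of the \<open>m\<close> variables. The only order in which these matrices have
  a nonzero product is the one along the path, so a nonzero multilinear polynomial takes every
  value that is concentrated in one off-diagonal block. A matrix \<open>A\<close> in block \<open>(0, 0)\<close> is the
  product of \<open>A\<close> in block \<open>(0, 1)\<close> and the identity in block \<open>(1, 0)\<close>.
\<close>

section \<open>Evaluation as a linear and multiplicative map\<close>

lemma poly_mapping_eq_sum_single: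
  "p = (\<Sum>w\<in>Poly_Mapping.keys p. Poly_Mapping.single w (Poly_Mapping.lookup p w))"
  by (rule poly_mapping_eqI)
    (simp add: lookup_sum lookup_single when_def in_keys_iff)

lemma eval_word_map: "eval_word a (map f w) = eval_word (a \<circ> f) w"
  by (induction "a \<circ> f" w rule: eval_word.induct) auto

context
  fixes scale :: "'a::field \<Rightarrow> 'b::ring \<Rightarrow> 'b"
  assumes vs: "vector_space scale"
begin

interpretation vector_space scale by (rule vs)

text \<open>Keys may cancel in a sum of polynomials; a common finite superset of the keys lets such
  evaluations be added term by term.\<close>

lemma eval_poly_superset:
  assumes "finite S" "Poly_Mapping.keys p \<subseteq> S"
  shows "eval_poly scale a p
    = (\<Sum>w\<in>S. scale (Poly_Mapping.lookup p w) (eval_word a (letters w)))"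
  unfolding eval_poly_def using assms
  by (intro sum.mono_neutral_left) (auto simp: in_keys_iff)

lemma eval_poly_zero: "eval_poly scale a 0 = 0"
  by (simp add: eval_poly_def)

lemma eval_poly_add: "eval_poly scale a (p + q) = eval_poly scale a p + eval_poly scale a q"
proof -
  let ?S = "Poly_Mapping.keys p \<union> Poly_Mapping.keys q"
  have "Poly_Mapping.keys (p + q) \<subseteq> ?S"
    by (rule Poly_Mapping.keys_add)
  then show ?thesis
    by (simp add: eval_poly_superset[of ?S] lookup_add scale_left_distrib sum.distrib)
qed

lemma eval_poly_sum: "eval_poly scale a (\<Sum>i\<in>I. f i) = (\<Sum>i\<in>I. eval_poly scale a (f i))"
  by (induction I rule: infinite_finite_induct) (simp_all add: eval_poly_zero eval_poly_add)

lemma eval_poly_single: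
  "eval_poly scale a (Poly_Mapping.single w c) = scale c (eval_word a (letters w))"
  by (simp add: eval_poly_superset[of "{w}"])

text \<open>Both factors are expanded into monomials, where concatenation turns into multiplication.
  The empty word must be excluded because it evaluates to 0 instead of acting as a unit.\<close>

lemma eval_poly_mult:
  assumes scale_mult: "\<And>c x y. scale c x * y = scale c (x * y)"
      "\<And>c x y. x * scale c y = scale c (x * y)"
    and "0 \<notin> Poly_Mapping.keys p" "0 \<notin> Poly_Mapping.keys q"
  shows "eval_poly scale a (p * q) = eval_poly scale a p * eval_poly scale a q"
proof -
  let ?p = "Poly_Mapping.lookup p" and ?q = "Poly_Mapping.lookup q"
  let ?P = "Poly_Mapping.keys p" and ?Q = "Poly_Mapping.keys q"
  have word: "eval_word a (letters (u + v)) = eval_word a (letters u) * eval_word a (letters v)"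
    if "u \<in> ?P" "v \<in> ?Q" for u v
  proof -
    have "letters u \<noteq> []" "letters v \<noteq> []"
      using that assms(3,4) by (metis word.collapse zero_word_def)+
    then show ?thesis
      by (simp add: plus_word_def eval_word_append)
  qed
  have "p * q = (\<Sum>u\<in>?P. Poly_Mapping.single u (?p u)) * (\<Sum>v\<in>?Q. Poly_Mapping.single v (?q v))"
    by (intro arg_cong2[where f = "(*)"] poly_mapping_eq_sum_single)
  also have "eval_poly scale a \<dots> = (\<Sum>u\<in>?P. \<Sum>v\<in>?Q.
      scale (?p u) (eval_word a (letters u)) * scale (?q v) (eval_word a (letters v)))"
    unfolding sum_product eval_poly_sum mult_single eval_poly_single
    by (intro sum.cong refl) (simp add: word scale_mult)
  also have "\<dots> = eval_poly scale a p * eval_poly scale a q"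
    by (simp add: eval_poly_def sum_product)
  finally show ?thesis .
qed

end

lemma multilinear_zero_notin_keys:
  assumes "multilinear p"
  shows "0 \<notin> Poly_Mapping.keys p"
proof -
  obtain m x c where "1 \<le> m" and p: "p = (\<Sum>\<sigma> | \<sigma> permutes {..<m}.
      Poly_Mapping.single (Word (map (\<lambda>i. x (\<sigma> i)) [0..<m])) (c \<sigma>))"
    using assms unfolding multilinear_def by blast
  have "Poly_Mapping.lookup p 0 = 0"
    unfolding p using \<open>1 \<le> m\<close> by (simp add: lookup_sum lookup_single zero_word_def when_def)
  then show ?thesis
    by (simp add: in_keys_iff)
qed

section \<open>Block matrices of block size \<open>n\<close>\<close>

definition supported :: "nat \<Rightarrow> 'a::zero finmat \<Rightarrow> bool" where
  "supported n A \<longleftrightarrow> (\<forall>i j. entry A i j \<noteq> 0 \<longrightarrow> i < n \<and> j < n)"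

text \<open>Of an index, the quotient by \<open>n\<close> names the block and the remainder the
  place inside it. For \<open>n > 0\<close>, entries of \<open>A\<close> outside the upper left
  \<open>n\<close> by \<open>n\<close> corner are lost.\<close>

lift_definition block :: "nat \<Rightarrow> nat \<Rightarrow> nat \<Rightarrow> 'a::zero finmat \<Rightarrow> 'a finmat"
  is "\<lambda>n s t A i j. if i div n = s \<and> j div n = t then A (i mod n) (j mod n) else 0"
proof -
  fix n s t :: nat and A :: "nat \<Rightarrow> nat \<Rightarrow> 'a"
  assume A: "finite {(i, j). A i j \<noteq> 0}"
  have "{(i, j). (if i div n = s \<and> j div n = t then A (i mod n) (j mod n) else 0) \<noteq> 0}
    \<subseteq> (\<lambda>(i, j). (s * n + i, t * n + j)) ` {(i, j). A i j \<noteq> 0}"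
    by (auto simp: image_iff split: if_splits intro!: exI[of _ "_ mod n"])
  then show "finite {(i, j). (if i div n = s \<and> j div n = t then A (i mod n) (j mod n) else 0) \<noteq> 0}"
    by (rule finite_subset) (use A in simp)
qed

text \<open>A local replacement for the unit that the finitary algebra does not have.\<close>

lift_definition unit_mat :: "nat \<Rightarrow> 'a::zero_neq_one finmat"
  is "\<lambda>n i j. if i = j \<and> i < n then 1 else 0"
  by (rule finite_subset[of _ "{..<n} \<times> {..<n}" for n]) (auto split: if_splits)

lemma supported_unit_mat: "supported n (unit_mat n)"
  by (simp add: supported_def unit_mat.rep_eq)

lemma entry_mult_supported:
  assumes "supported n A"
  shows "entry (A * B) i j = (\<Sum>k<n. entry A i k * entry B k j)"
  unfolding times_finmat.rep_eq using assms unfolding supported_def by (rule matprod_eq_sum)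

lemma mult_unit_mat:
  fixes A :: "'a::ring_1 finmat"
  assumes "supported n A"
  shows "A * unit_mat n = A"
proof (rule entry_inject[THEN iffD1], intro ext)
  fix i j
  have "entry (A * unit_mat n) i j = (\<Sum>k<n. if k = j then entry A i k else 0)"
    unfolding entry_mult_supported[OF assms] by (intro sum.cong) (auto simp: unit_mat.rep_eq)
  also have "\<dots> = entry A i j"
    using assms by (auto simp: supported_def)
  finally show "entry (A * unit_mat n) i j = entry A i j" .
qed

lemma block_mult_zero:
  fixes A B :: "'a::ring finmat"
  assumes "t \<noteq> t'"
  shows "block n s t A * block n t' u B = 0"
proof (rule entry_inject[THEN iffD1], intro ext)
  fix i j
  have "entry (block n s t A) i k * entry (block n t' u B) k j = 0" for k
    using assms by (simp add: block.rep_eq)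
  then show "entry (block n s t A * block n t' u B) i j = entry 0 i j"
    by (simp add: times_finmat.rep_eq zero_finmat.rep_eq)
qed

text \<open>Only inner indices in block \<open>t\<close> contribute. They correspond to the inner
  indices below \<open>n\<close> of \<open>A * B\<close>, and these are all that matter because
  \<open>A\<close> is supported there.\<close>

lemma block_mult:
  fixes A B :: "'a::ring finmat"
  assumes n: "0 < n" and A: "supported n A"
  shows "block n s t A * block n t u B = block n s u (A * B)"
proof (rule entry_inject[THEN iffD1], intro ext)
  fix i j
  let ?f = "\<lambda>k. entry (block n s t A) i k * entry (block n t u B) k j"
  have "{k. ?f k \<noteq> 0} \<subseteq> (\<lambda>k. t * n + k) ` {..<n}"
  proof
    fix k
    assume "k \<in> {k. ?f k \<noteq> 0}"
    then have "k div n = t"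
      by (auto simp: block.rep_eq split: if_splits)
    then have "k = t * n + k mod n"
      by (metis div_mult_mod_eq)
    then show "k \<in> (\<lambda>k. t * n + k) ` {..<n}"
      using n by (intro image_eqI[of _ _ "k mod n"]) auto
  qed
  then have "(\<Sum>k. ?f k) = sum ?f ((\<lambda>k. t * n + k) ` {..<n})"
    by (intro Sum_any.expand_superset) auto
  also have "\<dots> = (\<Sum>k<n. ?f (t * n + k))"
    by (subst sum.reindex) (auto simp: inj_on_def)
  also have "\<dots> = (\<Sum>k<n. if i div n = s \<and> j div n = u
      then entry A (i mod n) k * entry B k (j mod n) else 0)"
    by (intro sum.cong) (auto simp: block.rep_eq)
  also have "\<dots> = entry (block n s u (A * B)) i j"
    by (cases "i div n = s \<and> j div n = u")
      (auto simp: block.rep_eq entry_mult_supported[OF A] intro!: sum.neutral)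
  finally show "entry (block n s t A * block n t u B) i j = entry (block n s u (A * B)) i j"
    by (simp add: times_finmat.rep_eq)
qed

lemma block_0_0:
  assumes "supported n A"
  shows "block n 0 0 A = A"
proof (rule entry_inject[THEN iffD1], intro ext)
  fix i j
  show "entry (block n 0 0 A) i j = entry A i j"
  proof (cases "i < n \<and> j < n")
    case True
    then show ?thesis
      by (simp add: block.rep_eq)
  next
    case False
    then have "entry A i j = 0"
      using assms by (auto simp: supported_def)
    \<comment> \<open>For \<open>n = 0\<close> the convention \<open>i div 0 = 0\<close> makes the
      premises vacuous, but then \<open>A\<close> has no nonzero entry.\<close>
    moreover have "entry A (i mod n) (j mod n) = 0" if "i div n = 0" "j div n = 0"
      using False that assms by (cases "n = 0") (auto simp: supported_def div_eq_0_iff)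
    ultimately show ?thesis
      by (simp add: block.rep_eq)
  qed
qed

section \<open>Multilinear polynomials evaluated along a path of blocks\<close>

text \<open>Two adjacent factors are composable only if their variables are successive edges of the
  path. \<open>A\<close> sits on edge 0 alone; as no later edge of a run is edge 0, a surviving
  product keeps the content of its first edge.\<close>

lemma eval_word_block_path:
  fixes A :: "'a::ring_1 finmat" and n :: nat and b :: "nat \<Rightarrow> nat"
  defines "Y \<equiv> \<lambda>k. if k = 0 then A else unit_mat n"
  assumes n: "0 < n" and A: "supported n A" and b: "inj_on b {..m}"
    and w: "set (k # w) \<subseteq> {..<m}"
  shows "eval_word (\<lambda>k. block n (b k) (b (Suc k)) (Y k)) (k # w) =
    (if w = [Suc k..<Suc k + length w] then block n (b k) (b (Suc k + length w)) (Y k) else 0)"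
  using w
proof (induction w arbitrary: k)
  case (Cons l w)
  have Y: "supported n (Y k)"
    using A by (simp add: Y_def supported_unit_mat)
  \<comment> \<open>Since \<open>k\<close> and \<open>l\<close> are below \<open>m\<close>, both
    \<open>Suc k\<close> and \<open>l\<close> lie in \<open>{..m}\<close>, where \<open>b\<close> is
    injective.\<close>
  have "b (Suc k) = b l \<longleftrightarrow> Suc k = l"
    using Cons.prems b by (auto simp: inj_on_def)
  moreover have "Y k * Y (Suc k) = Y k"
    using mult_unit_mat[OF Y] by (simp add: Y_def)
  moreover have "l # w = [Suc k..<Suc k + length (l # w)]
      \<longleftrightarrow> l = Suc k \<and> w = [Suc l..<Suc l + length w]"
  proof -
    have "[Suc k..<Suc k + length (l # w)] = Suc k # [Suc (Suc k)..<Suc (Suc k) + length w]"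
      by (subst upt_rec) simp
    then show ?thesis
      by (simp only:) auto
  qed
  ultimately show ?case
    using Cons.IH[of l] Cons.prems by (auto simp: block_mult[OF n Y] block_mult_zero)
qed simp

lemma permutes_consecutive_eq_id:
  assumes \<tau>: "\<tau> permutes {..<m}" and "map \<tau> [0..<m] = [k..<k + m]"
  shows "\<tau> = id"
proof (rule ext)
  fix i
  have eq: "\<tau> i = k + i" if "i < m" for i
    using arg_cong[OF assms(2), of "\<lambda>xs. xs ! i"] that by simp
  \<comment> \<open>The last value \<open>k + (m - 1)\<close> must still be below
    \<open>m\<close>.\<close>
  have "k = 0" if "0 < m"
    using eq[of "m - 1"] permutes_in_image[OF \<tau>, of "m - 1"] that by simp
  then show "\<tau> i = id i"
    using eq[of i] permutes_not_in[OF \<tau>, of i] by (cases "i < m") auto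
qed

text \<open>The path follows the variables in the order of one monomial with nonzero coefficient, so
  every other monomial vanishes. Its vertices are distinct, hence
  \<open>s \<noteq> t\<close>.\<close>

lemma multilinear_block_value:
  fixes p :: "'a::field free_algebra" and A :: "'a finmat"
  assumes "multilinear p" "p \<noteq> 0" "s \<noteq> t" "0 < n" and A: "supported n A"
  shows "\<exists>a. eval_poly finmat_scale a p = block n s t A"
proof -
  interpret vector_space "finmat_scale :: 'a \<Rightarrow> _"
    by (rule vector_space_finmat_scale)
  obtain m x c where m: "1 \<le> m" and x: "inj_on x {..<m}"
    and p: "p = (\<Sum>\<sigma> | \<sigma> permutes {..<m}.
      Poly_Mapping.single (Word (map (\<lambda>i. x (\<sigma> i)) [0..<m])) (c \<sigma>))"
    using assms(1) unfolding multilinear_def by blast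
  have "\<exists>\<sigma>. \<sigma> permutes {..<m} \<and> c \<sigma> \<noteq> 0"
  proof (rule ccontr)
    assume "\<nexists>\<sigma>. \<sigma> permutes {..<m} \<and> c \<sigma> \<noteq> 0"
    then have "c \<sigma> = 0" if "\<sigma> permutes {..<m}" for \<sigma>
      using that by blast
    then have "p = 0"
      unfolding p by (intro sum.neutral) simp
    with assms(2) show False
      by simp
  qed
  then obtain \<sigma>\<^sub>0 where \<sigma>\<^sub>0: "\<sigma>\<^sub>0 permutes {..<m}" and c: "c \<sigma>\<^sub>0 \<noteq> 0"
    by blast
  \<comment> \<open>Scaling in advance cancels the coefficient of the surviving monomial.\<close>
  define B where "B = finmat_scale (inverse (c \<sigma>\<^sub>0)) A"
  \<comment> \<open>For \<open>i > 0\<close> the vertex \<open>s + t + i\<close> exceeds both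
    endpoints, so inner vertices never meet them.\<close>
  define b where "b i = (if i = 0 then s else if i = m then t else s + t + i)" for i
  define M where "M k = block n (b k) (b (Suc k)) (if k = 0 then B else unit_mat n)" for k
  \<comment> \<open>The variable \<open>x (\<sigma>\<^sub>0 k)\<close>, in place \<open>k\<close> of
    the chosen monomial, receives edge \<open>k\<close>.\<close>
  define a where "a = M \<circ> inv \<sigma>\<^sub>0 \<circ> the_inv_into {..<m} x"
  have B: "supported n B"
    using A by (auto simp: B_def supported_def finmat_scale.rep_eq)
  have b: "inj_on b {..m}"
    using \<open>s \<noteq> t\<close> by (auto simp: inj_on_def b_def)
  have word: "eval_word a (map (\<lambda>i. x (\<sigma> i)) [0..<m]) = (if \<sigma> = \<sigma>\<^sub>0 then block n s t B else 0)"
    if \<sigma>: "\<sigma> permutes {..<m}" for \<sigma>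
  proof -
    \<comment> \<open>\<open>\<tau> i\<close> is the edge that the \<open>i\<close>-th letter of the
      monomial of \<open>\<sigma>\<close> receives.\<close>
    define \<tau> where "\<tau> = inv \<sigma>\<^sub>0 \<circ> \<sigma>"
    have \<tau>: "\<tau> permutes {..<m}"
      unfolding \<tau>_def using \<sigma> permutes_inv[OF \<sigma>\<^sub>0] by (rule permutes_compose)
    have list: "map \<tau> [0..<m] = \<tau> 0 # map \<tau> [1..<m]"
      using m by (simp add: upt_rec[of 0])
    have range: "set (\<tau> 0 # map \<tau> [1..<m]) \<subseteq> {..<m}"
      unfolding list[symmetric] by (simp add: permutes_image[OF \<tau>] lessThan_atLeast0[symmetric])
    have \<tau>_id: "\<tau> = id \<longleftrightarrow> \<sigma> = \<sigma>\<^sub>0"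
      unfolding \<tau>_def using permutes_inv_o[OF \<sigma>\<^sub>0] by (metis comp_assoc comp_id id_comp)
    have "a (x (\<sigma> i)) = (M \<circ> \<tau>) i" if "i < m" for i
      using that permutes_in_image[OF \<sigma>, of i] by (simp add: a_def \<tau>_def the_inv_into_f_f[OF x])
    then have "eval_word a (map (\<lambda>i. x (\<sigma> i)) [0..<m]) = eval_word (M \<circ> \<tau>) [0..<m]"
      unfolding eval_word_map by (intro eval_word_cong) auto
    also have "\<dots> = eval_word M (\<tau> 0 # map \<tau> [1..<m])"
      by (simp only: eval_word_map[symmetric] list)
    \<comment> \<open>The tail has length \<open>m - 1\<close>, so the run ends at
      \<open>Suc (\<tau> 0) + (m - 1) = \<tau> 0 + m\<close>.\<close>
    also have "\<dots> = (if map \<tau> [1..<m] = [Suc (\<tau> 0)..<\<tau> 0 + m]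
        then block n (b (\<tau> 0)) (b (\<tau> 0 + m)) (if \<tau> 0 = 0 then B else unit_mat n) else 0)"
      unfolding M_def eval_word_block_path[OF \<open>0 < n\<close> B b range] using m by simp
    also have "\<dots> = (if \<tau> = id then block n s t B else 0)"
    proof (cases "map \<tau> [1..<m] = [Suc (\<tau> 0)..<\<tau> 0 + m]")
      case True
      then have "map \<tau> [0..<m] = [\<tau> 0..<\<tau> 0 + m]"
        using m unfolding list by (simp add: upt_rec[of "\<tau> 0"])
      with \<tau> have "\<tau> = id"
        by (rule permutes_consecutive_eq_id)
      then show ?thesis
        using m by (simp add: b_def)
    qed (use m in \<open>auto simp: map_idI\<close>)
    finally show ?thesis
      by (simp add: \<tau>_id)
  qed
  have "eval_poly finmat_scale a p = (\<Sum>\<sigma> | \<sigma> permutes {..<m}.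
      finmat_scale (c \<sigma>) (eval_word a (map (\<lambda>i. x (\<sigma> i)) [0..<m])))"
    unfolding p eval_poly_sum[OF vector_space_finmat_scale]
      eval_poly_single[OF vector_space_finmat_scale] by simp
  also have "\<dots> = (\<Sum>\<sigma> | \<sigma> permutes {..<m}.
      if \<sigma> = \<sigma>\<^sub>0 then finmat_scale (c \<sigma>\<^sub>0) (block n s t B) else 0)"
    by (intro sum.cong) (auto simp: word scale_zero_right)
  also have "\<dots> = finmat_scale (c \<sigma>\<^sub>0) (block n s t B)"
    using \<sigma>\<^sub>0 by (simp add: finite_permutations)
  also have "\<dots> = block n s t A"
    using c by (intro entry_inject[THEN iffD1] ext)
      (simp add: B_def block.rep_eq finmat_scale.rep_eq)
  finally show ?thesis
    by blast
qed

theorem theorem34: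
  fixes p p1 p2 :: "'a::field free_algebra"
  assumes "infinite (UNIV :: 'a set)"
    and "p = p1 * p2"
    and "multilinear p1" and "multilinear p2"
    and "vars p1 \<inter> vars p2 = {}"
    and "poly_image finmat_scale p1 \<noteq> {0}"
    and "poly_image finmat_scale p2 \<noteq> {0}"
  shows "poly_image finmat_scale p = (UNIV :: 'a finmat set)"
proof -
  \<comment> \<open>Thus nonzero images force \<open>p1\<close> and \<open>p2\<close> to be nonzero
    polynomials.\<close>
  have zero: "poly_image finmat_scale (0 :: 'a free_algebra) = {0}"
    by (simp add: poly_image_def eval_poly_zero[OF vector_space_finmat_scale])
  have "A \<in> poly_image finmat_scale p" for A :: "'a finmat"
  proof -
    obtain n\<^sub>0 where "\<forall>i j. entry A i j \<noteq> 0 \<longrightarrow> i < n\<^sub>0 \<and> j < n\<^sub>0"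
      using entry_bounded by blast
    \<comment> \<open>The successor keeps the block size positive even if the bound is 0.\<close>
    define n where "n = Suc n\<^sub>0"
    then have n: "0 < n" and A: "supported n A"
      using \<open>\<forall>i j. _\<close> by (auto simp: supported_def less_Suc_eq)
    obtain a1 where a1: "eval_poly finmat_scale a1 p1 = block n 0 1 A"
      using multilinear_block_value[OF assms(3) _ _ n A, of 0 1] assms(6) zero by auto
    obtain a2 where a2: "eval_poly finmat_scale a2 p2 = block n 1 0 (unit_mat n :: 'a finmat)"
      using multilinear_block_value[OF assms(4) _ _ n supported_unit_mat, of 1 0] assms(7) zero
      by auto
    \<comment> \<open>Disjointness of the variables allows both assignments to be realized at
      once.\<close>
    define a where "a v = (if v \<in> vars p1 then a1 v else a2 v)" for v
    have "eval_poly finmat_scale a p = eval_poly finmat_scale a p1 * eval_poly finmat_scale a p2"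
      unfolding assms(2) using assms(3,4)
      by (intro eval_poly_mult vector_space_finmat_scale finmat_scale_mult
          multilinear_zero_notin_keys)
    also have "eval_poly finmat_scale a p1 = eval_poly finmat_scale a1 p1"
      by (rule eval_poly_cong) (simp add: a_def)
    also have "eval_poly finmat_scale a p2 = eval_poly finmat_scale a2 p2"
      using assms(5) by (intro eval_poly_cong) (auto simp: a_def)
    also have "eval_poly finmat_scale a1 p1 * eval_poly finmat_scale a2 p2 = A"
      by (simp only: a1 a2 block_mult[OF n A] mult_unit_mat[OF A] block_0_0[OF A])
    finally show ?thesis
      unfolding poly_image_def by blast
  qed
  then show ?thesis
    by blast
qed

end
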